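(* Let $k\ge 1$ and $n\geq 2k+1$ be integers, and let $S\subseteq V(K_{n:k})$ be a set of vertices of the Kneser graph $K_{n:k}$. Then $S$ is a determining set of $K_{n:k}$ if and only if the associated $k$-regular hypergraph $\mathcal{H}_S$ is simple and has either $n$ or $n-1$ edges.
   Context: The Kneser graph $K_{n:k}$ has as vertices the $k$-element subsets of $[n]=\{1,\ldots,n\}$, two vertices being adjacent exactly when they are disjoint as sets. A set $S\subseteq V(G)$ of vertices of a finite graph $G$ is a determining set of $G$ if whenever $g,h\in\mathrm{Aut}(G)$ satisfy $g(s)=h(s)$ for all $s\in S$, then $g(v)=h(v)$ for all $v\in V(G)$. Hypergraphs are finite; edges (hyperedges) are non-empty subsets of the vertex set, of any size $\geq 1$ (an edge of size 1 is a loop), and edges may be repeated. A hypergraph is simple if no edge is repeated. The degree of a vertex is the number of edges containing it (a loop contributes 1), and a hypergraph is $k$-regular if every vertex has degree $k$. For $S\subseteq V(K_{n:k})$, the hypergraph $\mathcal{H}_S$ has vertex set $S$ and has one hyperedge $e_a=\{V\in S : a\in V\}$ for each element $a\in[n]$ that belongs to at least one vertex of $S$ (so distinct elements $a\ne b$ with $e_a=e_b$ give repeated edges, and an element appearing in exactly one vertex of $S$ gives a loop). This hypergraph is $k$-regular. *)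

theory Defs
  imports Main "HOL-Library.Multiset"
begin

record 'a graph =
  verts :: "'a set"
  edges :: "'a set set"

definition kneser_graph :: "nat \<Rightarrow> nat \<Rightarrow> nat set graph" where
  "kneser_graph n k =
    \<lparr> verts = {A. A \<subseteq> {1..n} \<and> card A = k},
      edges = {{A, B} | A B. A \<subseteq> {1..n} \<and> card A = k \<and> B \<subseteq> {1..n} \<and> card B = k \<and> A \<inter> B = {}} \<rparr>"

text \<open>An automorphism is a total function of which only the values on the vertex set matter.\<close>

definition graph_automorphism :: "'a graph \<Rightarrow> ('a \<Rightarrow> 'a) \<Rightarrow> bool" where
  "graph_automorphism G g \<longleftrightarrow>
    bij_betw g (verts G) (verts G) \<and>
    (\<forall>u\<in>verts G. \<forall>v\<in>verts G. {g u, g v} \<in> edges G \<longleftrightarrow> {u, v} \<in> edges G)"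

definition determining_set :: "'a graph \<Rightarrow> 'a set \<Rightarrow> bool" where
  "determining_set G S \<longleftrightarrow>
    S \<subseteq> verts G \<and>
    (\<forall>g h. graph_automorphism G g \<longrightarrow> graph_automorphism G h \<longrightarrow>
      (\<forall>s\<in>S. g s = h s) \<longrightarrow> (\<forall>v\<in>verts G. g v = h v))"

text \<open>Hyperedges form a multiset, since they may be repeated.\<close>

record 'a hypergraph =
  hverts :: "'a set"
  hedges :: "'a set multiset"

definition wf_hypergraph :: "'a hypergraph \<Rightarrow> bool" where
  "wf_hypergraph H \<longleftrightarrow>
    finite (hverts H) \<and> (\<forall>e\<in>#hedges H. e \<noteq> {} \<and> e \<subseteq> hverts H)"

definition simple_hypergraph :: "'a hypergraph \<Rightarrow> bool" where
  "simple_hypergraph H \<longleftrightarrow> (\<forall>e. count (hedges H) e \<le> 1)"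

definition num_hedges :: "'a hypergraph \<Rightarrow> nat" where
  "num_hedges H = size (hedges H)"

definition hdegree :: "'a hypergraph \<Rightarrow> 'a \<Rightarrow> nat" where
  "hdegree H v = size {# e \<in># hedges H. v \<in> e #}"

definition regular_hypergraph :: "nat \<Rightarrow> 'a hypergraph \<Rightarrow> bool" where
  "regular_hypergraph k H \<longleftrightarrow> (\<forall>v\<in>hverts H. hdegree H v = k)"

text \<open>
  The ground set of the Kneser graph is not a parameter: the elements \<open>a\<close> that belong to
  at least one vertex of \<open>S\<close> are those of \<open>\<Union>S\<close>.  The image is taken as a multiset, so
  distinct \<open>a\<close>, \<open>b\<close> lying in the same members of \<open>S\<close> give a repeated hyperedge.
\<close>

definition hypergraph_of :: "'b set set \<Rightarrow> 'b set hypergraph" where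
  "hypergraph_of S =
    \<lparr> hverts = S,
      hedges = image_mset (\<lambda>a. {V \<in> S. a \<in> V}) (mset_set (\<Union>S)) \<rparr>"

lemma kneser_vertex_sets_finite:
  assumes "S \<subseteq> verts (kneser_graph n k)"
  shows "finite S" and "finite (\<Union>S)"
proof -
  have *: "S \<subseteq> Pow {1..n}"
    using assms by (auto simp: kneser_graph_def)
  then show "finite S" by (rule finite_subset) simp
  from * have "\<Union>S \<subseteq> {1..n}" by blast
  then show "finite (\<Union>S)" by (rule finite_subset) simp
qed

lemma wf_hypergraph_of:
  assumes "S \<subseteq> verts (kneser_graph n k)"
  shows "wf_hypergraph (hypergraph_of S)"
  using kneser_vertex_sets_finite[OF assms]
  by (auto simp: wf_hypergraph_def hypergraph_of_def)

lemma regular_hypergraph_of: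
  assumes "S \<subseteq> verts (kneser_graph n k)"
  shows "regular_hypergraph k (hypergraph_of S)"
  unfolding regular_hypergraph_def
proof
  fix V assume "V \<in> hverts (hypergraph_of S)"
  then have V: "V \<in> S" by (simp add: hypergraph_of_def)
  then have "{a \<in> \<Union>S. a \<in> V} = V" by blast
  moreover have "card V = k"
    using V assms by (auto simp: kneser_graph_def)
  ultimately show "hdegree (hypergraph_of S) V = k"
    using V kneser_vertex_sets_finite[OF assms]
    by (simp add: hdegree_def hypergraph_of_def filter_mset_image_mset filter_mset_mset_set)
qed

end

theory Submission
  imports Defs
begin

text \<open>
  The equivalence rests on the fact that every automorphism of the Kneser graph with
  \<open>n \<ge> 2k + 1\<close> and \<open>k \<ge> 1\<close> is induced by a permutation of \<open>{1..n}\<close>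
  (\<open>kneser_automorphism_induced\<close>).

  Granting this, let \<open>e a = {V \<in> S. a \<in> V}\<close> for every \<open>a \<in> {1..n}\<close>.  Permutations \<open>\<sigma>\<close> and
  \<open>\<tau>\<close> agree on the members of \<open>S\<close> exactly when \<open>e a = e (\<tau>\<inverse> (\<sigma> a))\<close> for all \<open>a\<close>, so \<open>S\<close> is
  determining if \<open>e\<close> is injective on \<open>{1..n}\<close>; conversely, if \<open>e a = e b\<close> with \<open>a \<noteq> b\<close>, then
  the transposition of \<open>a\<close> and \<open>b\<close> fixes every member of \<open>S\<close> without fixing every vertex
  (\<open>determining_set_iff_inj_on\<close>).  Elements outside \<open>\<Union>S\<close> are those with \<open>e a = {}\<close>.  Hence
  injectivity of \<open>e\<close> on \<open>{1..n}\<close> means that no hyperedge is repeated and that at most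
  one element of \<open>{1..n}\<close> is missed by \<open>\<Union>S\<close>, and the number of hyperedges is \<open>card (\<Union>S)\<close>.

  Automorphisms are shown to be induced by permutations without the
  Erdos-Ko-Rado theorem.  The number of common neighbours of \<open>A\<close> and \<open>B\<close> is
  \<open>(n - card (A \<union> B)) choose k\<close>, and for \<open>n \<ge> 2k + 1\<close> its largest value over distinct pairs
  is attained only when \<open>card (A \<inter> B) = k - 1\<close>.  So an automorphism preserves adjacency in the
  Johnson graph (\<open>kneser_automorphism_preserves_johnson\<close>).  There, the \<open>k\<close>-sets containing a
  fixed \<open>(k-1)\<close>-set form a clique of \<open>n - k + 1\<close> vertices, too large to be a clique of the
  other kind, the \<open>k\<close>-subsets of a \<open>(k+1)\<close>-set (\<open>johnson_clique_core\<close>).  Such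
  cliques are therefore permuted, which yields a map of the same kind on \<open>(k-1)\<close>-sets, and
  one descends to singletons (\<open>johnson_map_induced\<close>).
\<close>

section \<open>Adjacency-preserving maps of Johnson graphs\<close>

abbreviation ksets :: "'a set \<Rightarrow> nat \<Rightarrow> 'a set set" where
  "ksets X k \<equiv> {A. A \<subseteq> X \<and> card A = k}"

abbreviation star :: "'a set \<Rightarrow> nat \<Rightarrow> 'a set \<Rightarrow> 'a set set" where
  "star X k C \<equiv> {A \<in> ksets X k. C \<subseteq> A}"

lemma inter_eq_remove:
  assumes "card Y = Suc k" "card (Y \<inter> A) = k" "y \<in> Y" "y \<notin> A"
  shows "Y \<inter> A = Y - {y}"
proof (rule card_subset_eq)
  show "finite (Y - {y})"
    using assms(1) by (metis card.infinite finite_Diff nat.distinct(1))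
  show "card (Y \<inter> A) = card (Y - {y})"
    using assms by (simp add: card_Diff_singleton)
qed (use assms in auto)

lemma card_Int_eq_iff_card_Un:
  assumes "card A = Suc k" "card B = Suc k"
  shows "card (A \<inter> B) = k \<longleftrightarrow> card (A \<union> B) = k + 2"
proof -
  have "finite A" "finite B"
    using assms card.infinite by fastforce+
  from card_Un_Int[OF this] show ?thesis
    using assms by linarith
qed

text \<open>
  If \<open>A\<close> and \<open>B\<close> are distinct members and some member \<open>X\<close> fails to contain \<open>A \<inter> B\<close>, then every
  member lies inside \<open>A \<union> B\<close>, for a member sticking out would have to meet \<open>A\<close>, \<open>B\<close> and \<open>X\<close> in
  one and the same set of \<open>k\<close> elements, namely \<open>A \<inter> B\<close>.  But \<open>A \<union> B\<close> has only \<open>k + 2\<close> subsets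
  of size \<open>k + 1\<close>.
\<close>

lemma johnson_clique_core:
  assumes sz: "\<And>A. A \<in> F \<Longrightarrow> card A = Suc k"
    and adj: "\<And>A B. A \<in> F \<Longrightarrow> B \<in> F \<Longrightarrow> A \<noteq> B \<Longrightarrow> card (A \<inter> B) = k"
    and big: "card F > k + 2"
  shows "\<exists>D. card D = k \<and> (\<forall>A\<in>F. D \<subseteq> A)"
proof -
  have "finite F" using big by (intro card_ge_0_finite) simp
  moreover have "\<not> card F \<le> Suc 0" using big by simp
  ultimately obtain A B where AB: "A \<in> F" "B \<in> F" "A \<noteq> B"
    using card_le_Suc0_iff_eq by blast
  define D where "D = A \<inter> B"
  have cD: "card D = k" using adj AB by (simp add: D_def)
  have finD: "finite D"
    using sz[OF AB(1)] by (metis D_def card.infinite finite_Int nat.distinct(1))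
  have "\<forall>X\<in>F. D \<subseteq> X"
  proof (rule ccontr)
    assume "\<not> ?thesis"
    then obtain X where X: "X \<in> F" "\<not> D \<subseteq> X" by blast
    \<comment> \<open>A member that sticks out of \<open>A \<union> B\<close> is \<open>D\<close> together with the element outside.\<close>
    have out: "Y - {y} = D" if Y: "Y \<in> F" "y \<in> Y" "y \<notin> A \<union> B" for Y y
    proof (rule card_subset_eq[OF finD])
      have "Y \<inter> A = Y - {y}"
        using Y by (intro inter_eq_remove[OF sz[OF Y(1)] adj[OF Y(1) AB(1)]]) auto
      moreover have "Y \<inter> B = Y - {y}"
        using Y by (intro inter_eq_remove[OF sz[OF Y(1)] adj[OF Y(1) AB(2)]]) auto
      ultimately show "Y - {y} \<subseteq> D" by (auto simp: D_def)
      show "card (Y - {y}) = card D"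
        using sz[OF Y(1)] Y(2) cD by (simp add: card_Diff_singleton)
    qed
    have XU: "X \<subseteq> A \<union> B" using out[OF X(1)] X(2) by blast
    have "F \<subseteq> ksets (A \<union> B) (Suc k)"
    proof
      fix Y assume Y: "Y \<in> F"
      have "Y \<subseteq> A \<union> B"
      proof
        fix y assume y: "y \<in> Y"
        show "y \<in> A \<union> B"
        proof (rule ccontr)
          assume n: "y \<notin> A \<union> B"
          then have "y \<notin> X" using XU by blast
          then have "Y \<inter> X = Y - {y}"
            using y by (intro inter_eq_remove[OF sz[OF Y] adj[OF Y X(1)]]) auto
          then show False using out[OF Y y n] X(2) by blast
        qed
      qed
      then show "Y \<in> ksets (A \<union> B) (Suc k)" using sz[OF Y] by simp
    qed
    moreover have cU: "card (A \<union> B) = k + 2"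
      using card_Int_eq_iff_card_Un[OF sz[OF AB(1)] sz[OF AB(2)]] adj[OF AB] by simp
    moreover have fU: "finite (A \<union> B)" by (rule card_ge_0_finite) (simp add: cU)
    moreover have "card (ksets (A \<union> B) (Suc k)) = k + 2"
      using n_subsets[OF fU, of "Suc k"] cU binomial_Suc_n[of "Suc k"] by simp
    ultimately have "card F \<le> k + 2"
      using card_mono[of "ksets (A \<union> B) (Suc k)" F] by simp
    then show False using big by simp
  qed
  then show ?thesis using cD by blast
qed

lemma star_eq_image:
  assumes "finite X" "C \<in> ksets X k"
  shows "star X (Suc k) C = (\<lambda>x. insert x C) ` (X - C)"
proof
  have finC: "finite C" using assms finite_subset by blast
  show "(\<lambda>x. insert x C) ` (X - C) \<subseteq> star X (Suc k) C"
    using assms finC by auto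
  show "star X (Suc k) C \<subseteq> (\<lambda>x. insert x C) ` (X - C)"
  proof
    fix A assume A: "A \<in> star X (Suc k) C"
    then have "card (A - C) = 1"
      using assms finC by (simp add: card_Diff_subset)
    then obtain x where "A - C = {x}" by (auto simp: card_1_singleton_iff)
    then have "A = insert x C" "x \<in> X - C" using A by blast+
    then show "A \<in> (\<lambda>x. insert x C) ` (X - C)" by blast
  qed
qed

lemma card_star:
  assumes "finite X" "C \<in> ksets X k"
  shows "card (star X (Suc k) C) = card X - k"
proof -
  have "inj_on (\<lambda>x. insert x C) (X - C)" by (auto simp: inj_on_def)
  then have "card (star X (Suc k) C) = card (X - C)"
    by (simp only: star_eq_image[OF assms] card_image)
  also have "\<dots> = card X - k"
    using assms finite_subset[of C X] by (simp add: card_Diff_subset)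
  finally show ?thesis .
qed

lemma star_inter:
  assumes "finite X" "C \<in> ksets X k" "A \<in> star X (Suc k) C" "B \<in> star X (Suc k) C" "A \<noteq> B"
  shows "A \<inter> B = C"
proof -
  have "A \<in> (\<lambda>x. insert x C) ` (X - C)" "B \<in> (\<lambda>x. insert x C) ` (X - C)"
    using assms(3,4) by (simp_all only: star_eq_image[OF assms(1,2)])
  then show ?thesis using assms(5) by blast
qed

lemma star_inj:
  assumes X: "finite X" "card X \<ge> k + 2"
    and C: "C \<in> ksets X k" "C' \<in> ksets X k" and eq: "star X (Suc k) C = star X (Suc k) C'"
  shows "C = C'"
proof -
  have "card (X - C) \<ge> 2"
    using X C finite_subset[of C X] by (simp add: card_Diff_subset)
  then have "\<not> card (X - C) \<le> Suc 0" by simp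
  then obtain x y where xy: "x \<in> X - C" "y \<in> X - C" "x \<noteq> y"
    using card_le_Suc0_iff_eq[of "X - C"] X(1) by blast
  then have m: "insert x C \<in> star X (Suc k) C" "insert y C \<in> star X (Suc k) C"
    and ne: "insert x C \<noteq> insert y C"
    using star_eq_image[OF X(1) C(1)] by blast+
  show ?thesis
    using star_inter[OF X(1) C(1) m ne] star_inter[OF X(1) C(2) m[unfolded eq] ne] by simp
qed

lemma distinct_subsets_inter:
  assumes "card A = Suc (Suc k)" "D \<subseteq> A" "E \<subseteq> A" "card D = Suc k" "card E = Suc k" "D \<noteq> E"
  shows "card (D \<inter> E) = k"
proof -
  have finA: "finite A" using assms(1) card.infinite by fastforce
  have "\<not> E \<subseteq> D"
    using card_subset_eq[of D E] assms finite_subset[OF _ finA] by auto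
  then have "D \<subset> D \<union> E" by blast
  then have "card D < card (D \<union> E)"
    using assms finA by (meson Un_least finite_subset psubset_card_mono)
  moreover have "card (D \<union> E) \<le> card A"
    using assms finA by (intro card_mono) auto
  ultimately have "card (D \<union> E) = k + 2" using assms by simp
  then show ?thesis using card_Int_eq_iff_card_Un assms by blast
qed

text \<open>
  Preservation of adjacency in one direction is enough: the sets are finite, so an injective
  self-map that sends a star into a star sends it onto that star.  The map \<open>\<phi>\<close> on the centres
  of the stars inherits the hypotheses because two centres are adjacent exactly when they are
  distinct and their stars meet.  A set of at least two elements is the union of its
  subsets of one element less, so the permutation inducing \<open>\<phi>\<close> also induces \<open>f\<close>.
\<close>

lemma johnson_map_induced:
  assumes X: "finite X" "card X \<ge> 2 * Suc k + 1"
    and f: "\<And>A. A \<in> ksets X (Suc k) \<Longrightarrow> f A \<in> ksets X (Suc k)"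
    and inj: "inj_on f (ksets X (Suc k))"
    and adj: "\<And>A B. A \<in> ksets X (Suc k) \<Longrightarrow> B \<in> ksets X (Suc k) \<Longrightarrow> card (A \<inter> B) = k
      \<Longrightarrow> card (f A \<inter> f B) = k"
  shows "\<exists>\<sigma>. bij_betw \<sigma> X X \<and> (\<forall>A\<in>ksets X (Suc k). f A = \<sigma> ` A)"
  using X(2) f inj adj
proof (induction k arbitrary: f)
  case 0
  have single: "\<exists>y\<in>X. f {x} = {y}" if "x \<in> X" for x
    using 0(2)[of "{x}"] that by (auto simp: card_1_singleton_iff)
  then obtain \<sigma> where \<sigma>: "\<And>x. x \<in> X \<Longrightarrow> \<sigma> x \<in> X \<and> f {x} = {\<sigma> x}" by metis
  have "inj_on \<sigma> X"
  proof (rule inj_onI)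
    fix x y assume xy: "x \<in> X" "y \<in> X" "\<sigma> x = \<sigma> y"
    then have "f {x} = f {y}" using \<sigma> by simp
    then show "x = y" using inj_onD[OF 0(3), of "{x}" "{y}"] xy by simp
  qed
  moreover have "\<sigma> ` X \<subseteq> X" using \<sigma> by blast
  ultimately have "bij_betw \<sigma> X X"
    using X(1) by (simp add: bij_betw_def endo_inj_surj)
  moreover have "f A = \<sigma> ` A" if "A \<in> ksets X (Suc 0)" for A
    using that \<sigma> by (auto simp: card_1_singleton_iff)
  ultimately show ?case by blast
next
  case (Suc k)
  let ?k = "Suc k"
  have finK: "finite (ksets X m)" for m using X(1) by simp
  have ex: "\<exists>D. D \<in> ksets X ?k \<and> f ` star X (Suc ?k) C = star X (Suc ?k) D"
    if C: "C \<in> ksets X ?k" for C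
  proof -
    let ?F = "f ` star X (Suc ?k) C"
    have injC: "inj_on f (star X (Suc ?k) C)"
      using Suc.prems(3) by (rule inj_on_subset) blast
    have cF: "card ?F = card X - ?k"
      using card_image[OF injC] card_star[OF X(1) C] by simp
    have sub: "?F \<subseteq> ksets X (Suc ?k)" using Suc.prems(2) by blast
    have "\<exists>D. card D = ?k \<and> (\<forall>A\<in>?F. D \<subseteq> A)"
    proof (rule johnson_clique_core)
      show "card A = Suc ?k" if "A \<in> ?F" for A using sub that by blast
      show "card (A \<inter> B) = ?k" if AB: "A \<in> ?F" "B \<in> ?F" "A \<noteq> B" for A B
      proof -
        from AB obtain A' B' where A': "A' \<in> star X (Suc ?k) C" "A = f A'"
          and B': "B' \<in> star X (Suc ?k) C" "B = f B'" by blast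
        then have "A' \<inter> B' = C" using AB(3) star_inter[OF X(1) C] by blast
        then show ?thesis using Suc.prems(4)[of A' B'] A' B' C by simp
      qed
      show "card ?F > ?k + 2" using cF Suc.prems(1) by simp
    qed
    then obtain D where D: "card D = ?k" "\<forall>A\<in>?F. D \<subseteq> A" by blast
    have "card ?F \<noteq> 0" using cF Suc.prems(1) by simp
    then have "?F \<noteq> {}" by (metis card.empty)
    then have DX: "D \<in> ksets X ?k" using D sub by blast
    have "?F = star X (Suc ?k) D"
    proof (rule card_subset_eq)
      show "finite (star X (Suc ?k) D)" using finK by (rule finite_subset[rotated]) blast
      show "?F \<subseteq> star X (Suc ?k) D" using D(2) sub by blast
      show "card ?F = card (star X (Suc ?k) D)" using cF card_star[OF X(1) DX] by simp
    qed
    then show ?thesis using DX by blast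
  qed
  then have "\<forall>C\<in>ksets X ?k. \<exists>D. D \<in> ksets X ?k \<and> f ` star X (Suc ?k) C = star X (Suc ?k) D"
    by blast
  from bchoice[OF this] obtain \<phi> where "\<forall>C\<in>ksets X ?k. \<phi> C \<in> ksets X ?k \<and>
      f ` star X (Suc ?k) C = star X (Suc ?k) (\<phi> C)" by (rule exE)
  then have \<phi>: "\<And>C. C \<in> ksets X ?k \<Longrightarrow> \<phi> C \<in> ksets X ?k"
    and st: "\<And>C. C \<in> ksets X ?k \<Longrightarrow> f ` star X (Suc ?k) C = star X (Suc ?k) (\<phi> C)"
    by (simp_all only: ball_simps Ball_def)
  have inj\<phi>: "inj_on \<phi> (ksets X ?k)"
  proof (rule inj_onI)
    fix C C' assume C: "C \<in> ksets X ?k" "C' \<in> ksets X ?k" "\<phi> C = \<phi> C'"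
    then have "f ` star X (Suc ?k) C = f ` star X (Suc ?k) C'" by (simp only: st)
    moreover have "star X (Suc ?k) C \<subseteq> ksets X (Suc ?k)" "star X (Suc ?k) C' \<subseteq> ksets X (Suc ?k)"
      by blast+
    ultimately have "star X (Suc ?k) C = star X (Suc ?k) C'"
      by (simp only: inj_on_image_eq_iff[OF Suc.prems(3)])
    then show "C = C'"
      using star_inj[OF X(1) _ C(1,2)] Suc.prems(1) by simp
  qed
  have contains: "\<phi> C \<subseteq> f A" if "C \<in> ksets X ?k" "A \<in> star X (Suc ?k) C" for C A
    using st[OF that(1)] that(2) by blast
  have adj\<phi>: "card (\<phi> C \<inter> \<phi> C') = k"
    if C: "C \<in> ksets X ?k" "C' \<in> ksets X ?k" "card (C \<inter> C') = k" for C C'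
  proof -
    have "card C \<noteq> card (C \<inter> C')" using C by simp
    then have "C \<noteq> C'" by (metis Int_absorb)
    then have ne: "\<phi> C \<noteq> \<phi> C'" by (simp only: inj_on_eq_iff[OF inj\<phi> C(1,2)] not_False_eq_True)
    have "card (C \<union> C') = Suc ?k" using C card_Int_eq_iff_card_Un[of C k C'] by simp
    then have A: "C \<union> C' \<in> star X (Suc ?k) C" "C \<union> C' \<in> star X (Suc ?k) C'" using C by auto
    have "card (f (C \<union> C')) = Suc ?k" using Suc.prems(2)[of "C \<union> C'"] A by blast
    then show ?thesis
      using contains[OF C(1) A(1)] contains[OF C(2) A(2)] \<phi>[OF C(1)] \<phi>[OF C(2)] ne
      by (intro distinct_subsets_inter) simp_all
  qed
  have "card X \<ge> 2 * ?k + 1" using Suc.prems(1) by simp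
  from Suc.IH[OF this \<phi> inj\<phi> adj\<phi>] obtain \<sigma>
    where \<sigma>: "bij_betw \<sigma> X X" "\<forall>C\<in>ksets X ?k. \<phi> C = \<sigma> ` C" by blast
  have "f A = \<sigma> ` A" if A: "A \<in> ksets X (Suc ?k)" for A
  proof -
    have fA: "f A \<in> ksets X (Suc ?k)" using Suc.prems(2) A by blast
    have "\<sigma> ` A \<subseteq> f A"
    proof (rule image_subsetI)
      fix a assume a: "a \<in> A"
      have "card (A - {a}) = ?k" using A a by (simp add: card_Diff_singleton)
      then have "A - {a} \<noteq> {}" by (metis card.empty nat.distinct(1))
      then obtain b where b: "b \<in> A" "b \<noteq> a" by blast
      have C: "A - {b} \<in> ksets X ?k" using A b by (auto simp: card_Diff_singleton)
      have "\<sigma> ` (A - {b}) \<subseteq> f A" using contains[OF C, of A] A \<sigma>(2) C by auto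
      then show "\<sigma> a \<in> f A" using a b by blast
    qed
    moreover have "card (\<sigma> ` A) = card (f A)"
      using fA A card_image[OF inj_on_subset[OF bij_betw_imp_inj_on[OF \<sigma>(1)]], of A] by simp
    moreover have "finite (f A)" using fA X(1) finite_subset[of "f A" X] by simp
    ultimately show ?thesis using card_subset_eq[of "f A" "\<sigma> ` A"] by simp
  qed
  then show ?case using \<sigma>(1) by blast
qed

section \<open>Automorphisms of Kneser graphs\<close>

lemma verts_kneser: "verts (kneser_graph n k) = ksets {1..n} k"
  by (simp add: kneser_graph_def)

lemma edge_kneser_iff:
  assumes "A \<in> ksets {1..n} k" "B \<in> ksets {1..n} k"
  shows "{A, B} \<in> edges (kneser_graph n k) \<longleftrightarrow> A \<inter> B = {}"
  using assms by (auto simp: kneser_graph_def doubleton_eq_iff)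

lemma kneser_automorphism_iff:
  "graph_automorphism (kneser_graph n k) g \<longleftrightarrow>
    bij_betw g (ksets {1..n} k) (ksets {1..n} k) \<and>
    (\<forall>A\<in>ksets {1..n} k. \<forall>B\<in>ksets {1..n} k. g A \<inter> g B = {} \<longleftrightarrow> A \<inter> B = {})"
  unfolding graph_automorphism_def verts_kneser
proof (intro conj_cong refl ball_cong)
  fix A B
  assume "bij_betw g (ksets {1..n} k) (ksets {1..n} k)"
    and A: "A \<in> ksets {1..n} k" and B: "B \<in> ksets {1..n} k"
  then have "g A \<in> ksets {1..n} k" "g B \<in> ksets {1..n} k"
    using bij_betwE by blast+
  then show "({g A, g B} \<in> edges (kneser_graph n k) \<longleftrightarrow> {A, B} \<in> edges (kneser_graph n k)) =
      (g A \<inter> g B = {} \<longleftrightarrow> A \<inter> B = {})"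
    by (simp only: edge_kneser_iff[OF A B] edge_kneser_iff)
qed

lemma bij_betw_image_ksets:
  assumes "finite X" "bij_betw \<sigma> X X"
  shows "bij_betw ((`) \<sigma>) (ksets X k) (ksets X k)"
proof -
  have inj: "inj_on ((`) \<sigma>) (ksets X k)"
    using inj_on_image_eq_iff[OF bij_betw_imp_inj_on[OF assms(2)]]
    by (intro inj_onI) simp
  moreover have "(`) \<sigma> ` ksets X k \<subseteq> ksets X k"
    using assms(2) by (auto simp: bij_betw_def card_image inj_on_subset)
  ultimately show ?thesis
    using assms(1) by (simp add: bij_betw_def endo_inj_surj)
qed

lemma permutation_kneser_automorphism:
  assumes "bij_betw \<sigma> {1..n} {1..n}"
  shows "graph_automorphism (kneser_graph n k) ((`) \<sigma>)"
proof -
  have "\<sigma> ` A \<inter> \<sigma> ` B = {} \<longleftrightarrow> A \<inter> B = {}" if "A \<subseteq> {1..n}" "B \<subseteq> {1..n}" for A B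
    using inj_on_image_Int[of \<sigma> "{1..n}" A B] that assms by (auto simp: bij_betw_def)
  then show ?thesis
    unfolding kneser_automorphism_iff using bij_betw_image_ksets[OF _ assms] by simp
qed

lemma card_common_neighbours:
  assumes "finite X" "A \<subseteq> X" "B \<subseteq> X"
  shows "card {C \<in> ksets X k. A \<inter> C = {} \<and> B \<inter> C = {}} = (card X - card (A \<union> B)) choose k"
proof -
  have "{C \<in> ksets X k. A \<inter> C = {} \<and> B \<inter> C = {}} = ksets (X - (A \<union> B)) k" by blast
  moreover have "card (X - (A \<union> B)) = card X - card (A \<union> B)"
    using assms by (simp add: card_Diff_subset finite_subset)
  ultimately show ?thesis using n_subsets[of "X - (A \<union> B)" k] assms by simp
qed

text \<open>
  Vertices are \<open>(k+1)\<close>-sets here.  Distinct ones have a union of at least \<open>k + 2\<close> elements,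
  and the pairs attaining this minimum have the most common neighbours.  The bound on \<open>n\<close>
  makes their number positive, and hence strictly larger than for any pair with a larger union.
\<close>

lemma kneser_automorphism_preserves_johnson:
  assumes n: "n \<ge> 2 * Suc k + 1"
    and g: "graph_automorphism (kneser_graph n (Suc k)) g"
    and A: "A \<in> ksets {1..n} (Suc k)" and B: "B \<in> ksets {1..n} (Suc k)"
    and AB: "card (A \<inter> B) = k"
  shows "card (g A \<inter> g B) = k"
proof -
  let ?V = "ksets {1..n} (Suc k)"
  let ?N = "\<lambda>A B. {C \<in> ?V. A \<inter> C = {} \<and> B \<inter> C = {}}"
  have bij: "bij_betw g ?V ?V"
    and disj: "\<And>A B. A \<in> ?V \<Longrightarrow> B \<in> ?V \<Longrightarrow> g A \<inter> g B = {} \<longleftrightarrow> A \<inter> B = {}"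
    using g unfolding kneser_automorphism_iff by blast+
  have gA: "g A \<in> ?V" and gB: "g B \<in> ?V" using bij A B bij_betwE by blast+
  have "?N (g A) (g B) = g ` ?N A B"
  proof
    show "g ` ?N A B \<subseteq> ?N (g A) (g B)"
    proof (rule image_subsetI)
      fix C assume C: "C \<in> ?N A B"
      then have CV: "C \<in> ?V" by simp
      then have "g C \<in> ?V" using bij bij_betwE by blast
      then show "g C \<in> ?N (g A) (g B)" using C disj[OF A CV] disj[OF B CV] by simp
    qed
    show "?N (g A) (g B) \<subseteq> g ` ?N A B"
    proof
      fix D assume D: "D \<in> ?N (g A) (g B)"
      then have "D \<in> g ` ?V" using bij_betw_imp_surj_on[OF bij] by simp
      then obtain C where C: "C \<in> ?V" "D = g C" by (rule imageE)
      then have "C \<in> ?N A B" using D disj[OF A C(1)] disj[OF B C(1)] by simp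
      then show "D \<in> g ` ?N A B" unfolding C(2) by (rule imageI)
    qed
  qed
  moreover have "inj_on g (?N A B)"
    using bij_betw_imp_inj_on[OF bij] by (rule inj_on_subset) blast
  ultimately have "card (?N (g A) (g B)) = card (?N A B)" by (simp only: card_image)
  then have "(n - card (g A \<union> g B)) choose Suc k = (n - card (A \<union> B)) choose Suc k"
    using card_common_neighbours[of "{1..n}" A B "Suc k"]
      card_common_neighbours[of "{1..n}" "g A" "g B" "Suc k"] A B gA gB by simp
  moreover have "card (A \<union> B) = k + 2"
    using card_Int_eq_iff_card_Un A B AB by blast
  ultimately have eq: "(n - card (g A \<union> g B)) choose Suc k = (n - (k + 2)) choose Suc k"
    by simp
  have "card A \<noteq> card (A \<inter> B)" using A AB by simp
  then have "A \<noteq> B" by (metis Int_absorb)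
  then have ne: "g A \<noteq> g B" using inj_on_eq_iff[OF bij_betw_imp_inj_on[OF bij] A B] by simp
  have "g A \<subseteq> {1..n}" "g B \<subseteq> {1..n}" using gA gB by simp_all
  then have fin: "finite (g A)" "finite (g B)"
    by (simp_all only: finite_subset[OF _ finite_atLeastAtMost])
  have "\<not> g B \<subseteq> g A" using card_subset_eq[OF fin(1)] gA gB ne by auto
  then have "card (g A) < card (g A \<union> g B)" using fin by (intro psubset_card_mono) auto
  then have lower: "card (g A \<union> g B) \<ge> k + 2" using gA by simp
  moreover have "card (g A \<union> g B) \<le> k + 2"
  proof (rule ccontr)
    assume "\<not> ?thesis"
    then have "(n - card (g A \<union> g B)) choose Suc k \<le> (n - (k + 3)) choose Suc k"
      by (intro binomial_right_mono) auto
    also have "\<dots> < (n - (k + 2)) choose Suc k"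
    proof -
      have "n - (k + 2) = Suc (n - (k + 3))" using n by simp
      moreover have "(n - (k + 3)) choose k > 0" using n by simp
      ultimately show ?thesis by simp
    qed
    finally show False using eq by simp
  qed
  ultimately show ?thesis using card_Int_eq_iff_card_Un gA gB by force
qed

lemma kneser_automorphism_induced:
  assumes k: "k \<ge> 1" and n: "n \<ge> 2 * k + 1"
    and g: "graph_automorphism (kneser_graph n k) g"
  shows "\<exists>\<sigma>. bij_betw \<sigma> {1..n} {1..n} \<and> (\<forall>A\<in>ksets {1..n} k. g A = \<sigma> ` A)"
proof -
  obtain j where j: "k = Suc j" using k by (cases k) auto
  have bij: "bij_betw g (ksets {1..n} k) (ksets {1..n} k)"
    using g unfolding kneser_automorphism_iff by blast
  show ?thesis
    unfolding j
  proof (rule johnson_map_induced)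
    show "g A \<in> ksets {1..n} (Suc j)" if "A \<in> ksets {1..n} (Suc j)" for A
      using bij that bij_betwE j by blast
    show "inj_on g (ksets {1..n} (Suc j))" using bij j by (simp add: bij_betw_def)
    show "card (g A \<inter> g B) = j"
      if "A \<in> ksets {1..n} (Suc j)" "B \<in> ksets {1..n} (Suc j)" "card (A \<inter> B) = j" for A B
      using kneser_automorphism_preserves_johnson[OF n[unfolded j] g[unfolded j] that] .
  qed (use n j in auto)
qed

section \<open>Determining sets and the associated hypergraph\<close>

text \<open>
  Elements lying in the same members of \<open>S\<close> can be exchanged without moving any member of \<open>S\<close>,
  so a determining set must tell all elements of \<open>{1..n}\<close> apart.  Conversely, if automorphisms
  induced by \<open>\<sigma>\<close> and \<open>\<tau>\<close> agree on \<open>S\<close>, then \<open>a\<close> and \<open>\<tau>\<inverse> (\<sigma> a)\<close> lie in the same members of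
  \<open>S\<close>, and if \<open>S\<close> tells elements apart this forces \<open>\<sigma> a = \<tau> a\<close>.
\<close>

lemma determining_set_iff_inj_on:
  assumes k: "k \<ge> 1" and n: "n \<ge> 2 * k + 1" and S: "S \<subseteq> verts (kneser_graph n k)"
  shows "determining_set (kneser_graph n k) S \<longleftrightarrow> inj_on (\<lambda>a. {V \<in> S. a \<in> V}) {1..n}"
proof
  assume det: "determining_set (kneser_graph n k) S"
  show "inj_on (\<lambda>a. {V \<in> S. a \<in> V}) {1..n}"
  proof (rule inj_onI, rule ccontr)
    fix a b assume ab: "a \<in> {1..n}" "b \<in> {1..n}" "{V \<in> S. a \<in> V} = {V \<in> S. b \<in> V}" "a \<noteq> b"
    define \<tau> where "\<tau> = id(a := b, b := a)"
    have "bij_betw \<tau> {1..n} {1..n}"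
      by (rule bij_betw_byWitness[where f' = \<tau>]) (use ab in \<open>auto simp: \<tau>_def\<close>)
    moreover have "bij_betw id {1..n} {1..n}" by simp
    ultimately have aut: "graph_automorphism (kneser_graph n k) ((`) \<tau>)"
      "graph_automorphism (kneser_graph n k) ((`) id)"
      by (simp_all only: permutation_kneser_automorphism)
    have "\<tau> ` V = id ` V" if V: "V \<in> S" for V
    proof -
      have "a \<in> V \<longleftrightarrow> b \<in> V" using ab(3) V by blast
      then show ?thesis by (auto simp: \<tau>_def image_iff)
    qed
    then have "\<forall>V\<in>S. \<tau> ` V = id ` V" by blast
    with det aut have fixed: "\<forall>V\<in>ksets {1..n} k. \<tau> ` V = id ` V"
      unfolding determining_set_def verts_kneser by presburger
    have "k - 1 \<le> card ({1..n} - {a, b})" using n ab by (simp add: card_Diff_subset)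
    then obtain W where W: "W \<subseteq> {1..n} - {a, b}" "card W = k - 1" "finite W"
      using obtain_subset_with_card_n by metis
    \<comment> \<open>A vertex containing \<open>a\<close> but not \<open>b\<close> is moved by the transposition.\<close>
    have aW: "a \<notin> W" "b \<notin> W" using W(1) by blast+
    have "insert a W \<in> ksets {1..n} k" using W ab k aW by auto
    from bspec[OF fixed this] have "\<tau> a \<in> insert a W" by (metis id_apply image_id image_eqI insertI1)
    then show False using aW ab by (simp add: \<tau>_def)
  qed
next
  have SV: "S \<subseteq> ksets {1..n} k" using S by (simp add: verts_kneser)
  assume inj: "inj_on (\<lambda>a. {V \<in> S. a \<in> V}) {1..n}"
  show "determining_set (kneser_graph n k) S"
    unfolding determining_set_def
  proof (intro conjI allI impI ballI S)
    fix g h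
    assume g: "graph_automorphism (kneser_graph n k) g"
      and h: "graph_automorphism (kneser_graph n k) h" and gh: "\<forall>s\<in>S. g s = h s"
    obtain \<sigma> where \<sigma>: "bij_betw \<sigma> {1..n} {1..n}" "\<forall>A\<in>ksets {1..n} k. g A = \<sigma> ` A"
      using kneser_automorphism_induced[OF k n g] by blast
    obtain \<tau> where \<tau>: "bij_betw \<tau> {1..n} {1..n}" "\<forall>A\<in>ksets {1..n} k. h A = \<tau> ` A"
      using kneser_automorphism_induced[OF k n h] by blast
    have agree: "\<sigma> a = \<tau> a" if a: "a \<in> {1..n}" for a
    proof -
      have "\<sigma> a \<in> \<tau> ` {1..n}" 
        using bij_betwE[OF \<sigma>(1)] bij_betw_imp_surj_on[OF \<tau>(1)] a by (simp only:)
      then obtain b where b: "b \<in> {1..n}" "\<sigma> a = \<tau> b" by blast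
      have "a \<in> V \<longleftrightarrow> b \<in> V" if V: "V \<in> S" for V
      proof -
        have VX: "V \<in> ksets {1..n} k" using V SV by blast
        have "\<sigma> ` V = \<tau> ` V" using gh V VX \<sigma>(2) \<tau>(2) by auto
        moreover have "a \<in> V \<longleftrightarrow> \<sigma> a \<in> \<sigma> ` V"
          using inj_on_image_mem_iff[of \<sigma> "{1..n}" a V] \<sigma>(1) a VX by (simp add: bij_betw_def)
        moreover have "b \<in> V \<longleftrightarrow> \<tau> b \<in> \<tau> ` V"
          using inj_on_image_mem_iff[of \<tau> "{1..n}" b V] \<tau>(1) b(1) VX by (simp add: bij_betw_def)
        ultimately show ?thesis using b(2) by simp
      qed
      then have "{V \<in> S. a \<in> V} = {V \<in> S. b \<in> V}" by blast
      then have "a = b" using inj_onD[OF inj _ a b(1)] by simp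
      then show ?thesis using b(2) by simp
    qed
    fix v assume "v \<in> verts (kneser_graph n k)"
    then have "v \<in> ksets {1..n} k" by (simp add: verts_kneser)
    then show "g v = h v"
      using \<sigma>(2) \<tau>(2) image_cong[OF refl, of v \<sigma> \<tau>] agree by (simp add: subset_iff)
  qed
qed

lemma count_image_mset_le_one_iff_inj_on:
  assumes "finite A"
  shows "(\<forall>y. count (image_mset f (mset_set A)) y \<le> 1) \<longleftrightarrow> inj_on f A"
proof -
  have "count (image_mset f (mset_set A)) y = card {x \<in> A. f x = y}" for y
    using assms by (simp add: count_image_mset' Collect_conj_eq ac_simps eq_commute[of y])
  moreover have "card {x \<in> A. f x = y} \<le> Suc 0 \<longleftrightarrow>
      (\<forall>x\<in>A. \<forall>x'\<in>A. f x = y \<longrightarrow> f x' = y \<longrightarrow> x = x')" for y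
    using assms card_le_Suc0_iff_eq[of "{x \<in> A. f x = y}"] by auto
  ultimately show ?thesis by (auto simp: inj_on_def)
qed

text \<open>
  An element of \<open>X\<close> has the empty set of members of \<open>S\<close> around it precisely when it is missed
  by \<open>\<Union>S\<close>; so the missed elements collide only with one another, and there may be at most one.
\<close>

lemma inj_on_membership_iff:
  assumes X: "finite X" "\<Union>S \<subseteq> X"
  shows "inj_on (\<lambda>a. {V \<in> S. a \<in> V}) X \<longleftrightarrow>
    inj_on (\<lambda>a. {V \<in> S. a \<in> V}) (\<Union>S) \<and> card X - 1 \<le> card (\<Union>S)"
proof -
  let ?e = "\<lambda>a. {V \<in> S. a \<in> V}"
  have U: "finite (\<Union>S)" using X by (rule finite_subset[rotated])
  have empty: "?e a = {} \<longleftrightarrow> a \<notin> \<Union>S" for a by blast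
  have "card X - 1 \<le> card (\<Union>S) \<longleftrightarrow> card (X - \<Union>S) \<le> Suc 0"
    using X U card_mono[OF X] by (auto simp: card_Diff_subset)
  also have "\<dots> \<longleftrightarrow> (\<forall>a\<in>X - \<Union>S. \<forall>b\<in>X - \<Union>S. a = b)"
    using X by (simp add: card_le_Suc0_iff_eq)
  also have "\<dots> \<longleftrightarrow> inj_on ?e (X - \<Union>S)"
  proof -
    have "?e a = ?e b" if "a \<in> X - \<Union>S" "b \<in> X - \<Union>S" for a b
      using that empty[of a] empty[of b] by blast
    then show ?thesis unfolding inj_on_def by blast
  qed
  finally have card: "card X - 1 \<le> card (\<Union>S) \<longleftrightarrow> inj_on ?e (X - \<Union>S)" .
  have "X = \<Union>S \<union> (X - \<Union>S)" using X by blast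
  moreover have "?e ` (\<Union>S - (X - \<Union>S)) \<inter> ?e ` (X - \<Union>S - \<Union>S) = {}"
    using empty by blast
  ultimately show ?thesis
    using inj_on_Un[of ?e "\<Union>S" "X - \<Union>S"] card by simp
qed

theorem lemma3p1:
  fixes n k :: nat and S :: "nat set set"
  assumes "k \<ge> 1"
    and "n \<ge> 2 * k + 1"
    and "S \<subseteq> verts (kneser_graph n k)"
  shows "determining_set (kneser_graph n k) S \<longleftrightarrow>
    simple_hypergraph (hypergraph_of S) \<and>
    (num_hedges (hypergraph_of S) = n \<or> num_hedges (hypergraph_of S) = n - 1)"
proof -
  have U: "\<Union>S \<subseteq> {1..n}" using assms(3) by (auto simp: verts_kneser)
  then have fin: "finite (\<Union>S)" by (rule finite_subset) simp
  have le: "card (\<Union>S) \<le> n" using card_mono[OF _ U] by simp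
  have num: "num_hedges (hypergraph_of S) = card (\<Union>S)"
    by (simp add: num_hedges_def hypergraph_of_def)
  have simple: "simple_hypergraph (hypergraph_of S) \<longleftrightarrow> inj_on (\<lambda>a. {V \<in> S. a \<in> V}) (\<Union>S)"
    using count_image_mset_le_one_iff_inj_on[OF fin]
    by (simp add: simple_hypergraph_def hypergraph_of_def)
  have "n - 1 \<le> card (\<Union>S) \<longleftrightarrow> card (\<Union>S) = n \<or> card (\<Union>S) = n - 1"
    using le by auto
  then show ?thesis
    unfolding num simple determining_set_iff_inj_on[OF assms]
    using inj_on_membership_iff[OF _ U] by simp
qed

end
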